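(* Let $\lambda_1$ be the first (smallest) positive eigenvalue of the normalized graph Laplacian $\mathcal{L}$ of $\Gamma$, and let $\theta_{\max}=\max_{e\in E(\Gamma)}\theta(e)$. Suppose there is a balanced homogeneous harmonic function $f:C(\Gamma,\theta)\to\mathbb{R}$ of degree $\alpha>0$ that is not identically zero. If $\Gamma$ is not a complete graph, then $$\alpha\ge\frac{1}{\theta_{\max}}\arccos(1-\lambda_1).$$ If $\Gamma=K_n$ is the complete graph on $n$ vertices, then $$\alpha\ge\frac{2}{\theta_{\max}}\arctan\left(\frac{n}{n-1}\right).$$
   Context: $\Gamma$ is a finite connected simplicial graph (no loops or multiple edges) with at least one edge, vertex set $V(\Gamma)=\{v_i\}$ and edge set $E(\Gamma)$; $v\sim w$ means adjacent. $\theta:E(\Gamma)\to(0,\pi)$ is a function. $S_{\theta_0}=\{(r,\theta): r\ge 0,\ 0\le\theta\le\theta_0\}$ is the Euclidean plane sector in polar coordinates. The normalized graph Laplacian is the symmetric positive semidefinite matrix $\mathcal{L}$ with $\mathcal{L}_{ii}=1$, $\mathcal{L}_{ij}=-1/\sqrt{\deg(v_i)\deg(v_j)}$ if $v_i\sim v_j$, and $\mathcal{L}_{ij}=0$ otherwise. The cone $C(\Gamma)=(\Gamma\times[0,\infty))/\!\sim$ collapses $\Gamma\times\{0\}$ to a point. $C(\Gamma,\theta)$ is $C(\Gamma)$ with the metric for which each face $C(e)$, $e\in E(\Gamma)$, is isometric to $S_{\theta(e)}$: identifying $e$ with $[0,1]$, $(x,t)\in C(e)$ corresponds to polar coordinates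 $(r,\theta)=(t,x\theta(e))$. If $v$ is an endpoint of $e$, the coordinates adapted to $v$ are those where $v$ corresponds to $0$, so that $C(v)=\{v\}\times[0,\infty)$ is the ray $\theta=0$. A homogeneous function $f:C(\Gamma,\theta)\to\mathbb{R}$ of degree $\alpha>0$ has the form $f(x,t)=\rho(x)t^\alpha$ with $\rho:\Gamma\to\mathbb{R}$ continuous. It is harmonic if its restriction to each face $C(e)$, expressed in the polar coordinates $(r,\theta)=(t,x\theta(e))$ identifying $C(e)$ with $S_{\theta(e)}$, is harmonic in the interior of the plane sector $S_{\theta(e)}$. It is balanced if for every $v\in V(\Gamma)$, $\sum_j\frac{\partial u_j}{\partial\theta}(r,0)=0$ for all $r>0$, where $e_j$ runs over the edges incident to $v$ and $u_j$ is $f|_{C(e_j)}$ in coordinates adapted to $v$. *)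

theory Defs
  imports "HOL-Analysis.Analysis"
begin

text \<open>Graphs have a finite type \<^typ>\<open>'v\<close> as vertex set and a set \<open>E\<close> of two-element
  vertex sets as edge set.\<close>

definition simple_graph :: "'v set set \<Rightarrow> bool" where
  "simple_graph E \<longleftrightarrow> (\<forall>e\<in>E. card e = 2)"

definition connected_graph :: "'v set set \<Rightarrow> bool" where
  "connected_graph E \<longleftrightarrow> (\<forall>v w. (v, w) \<in> {(x, y). {x, y} \<in> E}\<^sup>*)"

definition complete_graph :: "'v set set \<Rightarrow> bool" where
  "complete_graph E \<longleftrightarrow> (\<forall>v w. v \<noteq> w \<longrightarrow> {v, w} \<in> E)"

definition neighbours :: "'v set set \<Rightarrow> 'v \<Rightarrow> 'v set" where
  "neighbours E v = {w. {v, w} \<in> E}"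

definition vertex_degree :: "'v set set \<Rightarrow> 'v \<Rightarrow> nat" where
  "vertex_degree E v = card (neighbours E v)"

definition normalized_laplacian :: "'v::finite set set \<Rightarrow> real^'v^'v" where
  "normalized_laplacian E = (\<chi> i j.
     if i = j then 1
     else if {i, j} \<in> E then - 1 / sqrt (real (vertex_degree E i) * real (vertex_degree E j))
     else 0)"

definition eigenvalue :: "real^'n^'n \<Rightarrow> real \<Rightarrow> bool" where
  "eigenvalue A l \<longleftrightarrow> (\<exists>x. x \<noteq> 0 \<and> A *v x = l *\<^sub>R x)"

definition first_positive_eigenvalue :: "real^'n^'n \<Rightarrow> real" where
  "first_positive_eigenvalue A = Min {l. 0 < l \<and> eigenvalue A l}"

text \<open>The graph as a topological space is its geometric realization in barycentric
  coordinates: the vertex \<open>v\<close> is the standard basis vector \<open>axis v 1\<close> and the edge \<open>{v, w}\<close>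
  is the segment between two of these.  The identification of \<open>{v, w}\<close> with the unit
  interval in which \<open>v\<close> corresponds to \<open>0\<close> is \<open>edge_point v w\<close>.\<close>

definition edge_point :: "'v::finite \<Rightarrow> 'v \<Rightarrow> real \<Rightarrow> real^'v" where
  "edge_point v w s = (1 - s) *\<^sub>R axis v 1 + s *\<^sub>R axis w 1"

definition realization :: "'v::finite set set \<Rightarrow> (real^'v) set" where
  "realization E = range (\<lambda>v. axis v 1) \<union>
     {edge_point v w s | v w s. {v, w} \<in> E \<and> 0 \<le> s \<and> s \<le> 1}"

definition cone_rel :: "'a set \<Rightarrow> (('a \<times> real) \<times> ('a \<times> real)) set" where
  "cone_rel X = {(p, q). p \<in> X \<times> {0..} \<and> q \<in> X \<times> {0..} \<and> (p = q \<or> snd p = 0 \<and> snd q = 0)}"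

lemma equiv_cone_rel: "equiv (X \<times> {0..}) (cone_rel X)"
  by (rule equivI) (auto simp: cone_rel_def intro!: refl_onI symI transI)

definition cone_space :: "'a set \<Rightarrow> ('a \<times> real) set set" where
  "cone_space X = (X \<times> {0..}) // cone_rel X"

definition cone_point :: "'a set \<Rightarrow> 'a \<Rightarrow> real \<Rightarrow> ('a \<times> real) set" where
  "cone_point X x t = cone_rel X `` {(x, t)}"

definition sector :: "real \<Rightarrow> complex set" where
  "sector \<theta>\<^sub>0 = {rcis r \<phi> | r \<phi>. 0 \<le> r \<and> 0 \<le> \<phi> \<and> \<phi> \<le> \<theta>\<^sub>0}"

text \<open>The restriction of \<open>f\<close> to the face over the edge \<open>{v, w}\<close>, as a function of the polar
  coordinates \<open>(r, \<phi>)\<close> adapted to \<open>v\<close>; this is where the angle \<open>\<theta> {v, w}\<close>, and hence the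
  metric of the cone, enters.\<close>

definition face_fun ::
  "'v::finite set set \<Rightarrow> ('v set \<Rightarrow> real) \<Rightarrow> (((real^'v) \<times> real) set \<Rightarrow> real) \<Rightarrow>
   'v \<Rightarrow> 'v \<Rightarrow> real \<Rightarrow> real \<Rightarrow> real" where
  "face_fun E \<theta> f v w r \<phi> = f (cone_point (realization E) (edge_point v w (\<phi> / \<theta> {v, w})) r)"

text \<open>Harmonic functions on an open subset of the plane: twice continuously differentiable
  with vanishing Laplacian.\<close>

definition harmonic_on :: "complex set \<Rightarrow> (complex \<Rightarrow> real) \<Rightarrow> bool" where
  "harmonic_on S u \<longleftrightarrow> open S \<and>
     (\<exists>ux uy uxx uxy uyx uyy.
        (\<forall>z\<in>S. (u has_derivative (\<lambda>h. ux z * Re h + uy z * Im h)) (at z)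
             \<and> (ux has_derivative (\<lambda>h. uxx z * Re h + uxy z * Im h)) (at z)
             \<and> (uy has_derivative (\<lambda>h. uyx z * Re h + uyy z * Im h)) (at z)
             \<and> uxx z + uyy z = 0)
      \<and> continuous_on S uxx \<and> continuous_on S uxy
      \<and> continuous_on S uyx \<and> continuous_on S uyy)"

definition homogeneous ::
  "'v::finite set set \<Rightarrow> real \<Rightarrow> (((real^'v) \<times> real) set \<Rightarrow> real) \<Rightarrow> bool" where
  "homogeneous E \<alpha> f \<longleftrightarrow>
     (\<exists>\<rho>. continuous_on (realization E) \<rho> \<and>
        (\<forall>x\<in>realization E. \<forall>t\<ge>0. f (cone_point (realization E) x t) = \<rho> x * t powr \<alpha>))"

text \<open>Both orientations of each edge are considered below; they differ by a reflection of the
  sector, which preserves harmonicity.  As the angles are less than \<open>pi\<close>, the polar angle of a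
  point of the sector is its principal argument.\<close>

definition harmonic_on_faces ::
  "'v::finite set set \<Rightarrow> ('v set \<Rightarrow> real) \<Rightarrow> (((real^'v) \<times> real) set \<Rightarrow> real) \<Rightarrow> bool" where
  "harmonic_on_faces E \<theta> f \<longleftrightarrow>
     (\<forall>v w. {v, w} \<in> E \<longrightarrow>
        harmonic_on (interior (sector (\<theta> {v, w}))) (\<lambda>z. face_fun E \<theta> f v w (cmod z) (Arg z)))"

text \<open>The angular derivative is one-sided, since the ray over \<open>v\<close> bounds the sector.\<close>

definition balanced ::
  "'v::finite set set \<Rightarrow> ('v set \<Rightarrow> real) \<Rightarrow> (((real^'v) \<times> real) set \<Rightarrow> real) \<Rightarrow> bool" where
  "balanced E \<theta> f \<longleftrightarrow>
     (\<forall>v. \<forall>r>0. \<exists>D.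
        (\<forall>w\<in>neighbours E v.
           ((\<lambda>\<phi>. face_fun E \<theta> f v w r \<phi>) has_real_derivative D w) (at 0 within {0..\<theta> {v, w}}))
      \<and> (\<Sum>w\<in>neighbours E v. D w) = 0)"

end

theory Submission
  imports Defs
begin

text \<open>On each face a homogeneous harmonic function of degree \<open>\<alpha>\<close> is
  \<open>r\<^sup>\<alpha> (A cos \<alpha>\<phi> + B sin \<alpha>\<phi>)\<close>.  If \<open>X = \<alpha> \<theta>\<^sub>m\<^sub>a\<^sub>x < \<pi>\<close>, then \<open>A\<close> and \<open>B\<close> are determined by the values
  \<open>g\<close> at the two vertices, and the balancing condition says that \<open>g\<close> lies in the kernel of the
  quadratic form \<open>\<Sum>\<^sub>v\<^sub>w (2 g\<^sub>v g\<^sub>w - (g\<^sub>v\<^sup>2 + g\<^sub>w\<^sup>2) cos x\<^sub>v\<^sub>w) / sin x\<^sub>v\<^sub>w\<close> with \<open>x\<^sub>e = \<alpha> \<theta>(e)\<close>.  This form is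
  positive on constants, hence nonnegative on the plane spanned by \<open>g\<close> and the constants, and it
  increases with every \<open>x\<^sub>e\<close>, so it stays nonnegative there when all \<open>x\<^sub>e\<close> are replaced by \<open>X\<close>.
  Then it says that the Rayleigh quotient of the normalized Laplacian is at most
  \<open>1 - cos X\<close>; evaluating at a vector of the plane orthogonal to the kernel gives \<open>\<lambda>\<^sub>1 \<le> 1 - cos X\<close>.
  This bound holds for complete graphs too, where \<open>\<lambda>\<^sub>1 = n / (n - 1)\<close> makes it stronger than the
  bound claimed.\<close>

subsection \<open>Smallest eigenvalues of symmetric matrices\<close>

lemma symmetric_matrix_inner:
  fixes A :: "real^'n^'n"
  assumes "transpose A = A"
  shows "x \<bullet> (A *v y) = (A *v x) \<bullet> y"
  by (metis assms dot_lmul_matrix transpose_matrix_vector)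

text \<open>Eigenvectors for distinct eigenvalues are orthogonal, hence linearly independent, and
  there are only finitely many. Finiteness is what gives the \<open>Min\<close> in
  \<open>first_positive_eigenvalue\<close> its meaning.\<close>

lemma finite_eigenvalues_symmetric:
  fixes A :: "real^'n^'n"
  assumes sym: "transpose A = A"
  shows "finite {l. eigenvalue A l}"
proof -
  define ev where "ev l = (SOME x. x \<noteq> 0 \<and> A *v x = l *\<^sub>R x)" for l
  have ev: "ev l \<noteq> 0 \<and> A *v ev l = l *\<^sub>R ev l" if "eigenvalue A l" for l
    using that unfolding eigenvalue_def ev_def by (rule someI_ex)
  have orth: "ev l \<bullet> ev m = 0" if "eigenvalue A l" "eigenvalue A m" "l \<noteq> m" for l m
  proof -
    have "m * (ev l \<bullet> ev m) = l * (ev l \<bullet> ev m)"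
      using symmetric_matrix_inner[OF sym, of "ev l" "ev m"] ev[OF that(1)] ev[OF that(2)] by simp
    then show ?thesis using that(3) by simp
  qed
  have inj: "inj_on ev {l. eigenvalue A l}"
  proof (rule inj_onI)
    fix l m assume *: "l \<in> {l. eigenvalue A l}" "m \<in> {l. eigenvalue A l}" "ev l = ev m"
    show "l = m" using orth[of l m] ev[of l] * by (cases "l = m") auto
  qed
  have "pairwise orthogonal (ev ` {l. eigenvalue A l})"
    unfolding pairwise_def orthogonal_def using orth by auto
  moreover have "0 \<notin> ev ` {l. eigenvalue A l}" using ev by auto
  ultimately have "independent (ev ` {l. eigenvalue A l})"
    by (rule pairwise_orthogonal_independent)
  then have "finite (ev ` {l. eigenvalue A l})" by (rule independent_imp_finite)
  then show ?thesis using inj by (rule finite_imageD)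
qed

text \<open>The quadratic form attains its minimum \<open>m\<close> on the unit sphere of the
  hyperplane orthogonal to \<open>u\<close>, which is nonempty because of \<open>z\<close>. The
  residual of the eigenvalue equation at a minimizer lies in the same hyperplane, so the minimizer
  may be varied along it, and minimality forces it to vanish.\<close>

lemma Rayleigh_minimum_orthogonal:
  fixes A :: "real^'n^'n" and u z :: "real^'n"
  assumes sym: "transpose A = A" and Au: "A *v u = 0"
    and z: "z \<noteq> 0" "u \<bullet> z = 0"
  obtains m x where "x \<noteq> 0" "u \<bullet> x = 0" "A *v x = m *\<^sub>R x"
    "\<And>y. u \<bullet> y = 0 \<Longrightarrow> m * (y \<bullet> y) \<le> y \<bullet> (A *v y)"
proof -
  define K where "K = sphere 0 1 \<inter> {y. u \<bullet> y = 0}"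
  have "compact K" unfolding K_def by (intro compact_Int_closed closed_hyperplane) simp
  moreover have "z /\<^sub>R norm z \<in> K" using z by (simp add: K_def)
  then have "K \<noteq> {}" by blast
  moreover have "continuous_on K (\<lambda>y. y \<bullet> (A *v y))"
    by (intro continuous_intros)
  ultimately obtain x where x: "x \<in> K" and xmin: "\<And>y. y \<in> K \<Longrightarrow> x \<bullet> (A *v x) \<le> y \<bullet> (A *v y)"
    using continuous_attains_inf[of K "\<lambda>y. y \<bullet> (A *v y)"] by blast
  define m where "m = x \<bullet> (A *v x)"
  have xx: "x \<bullet> x = 1" "u \<bullet> x = 0" using x by (auto simp: K_def norm_eq_1)
  have min: "m * (y \<bullet> y) \<le> y \<bullet> (A *v y)" if "u \<bullet> y = 0" for y
  proof (cases "y = 0")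
    case False
    have "y /\<^sub>R norm y \<in> K" using that False by (simp add: K_def)
    from xmin[OF this] have "m \<le> (y \<bullet> (A *v y)) / (norm y)\<^sup>2"
      by (simp add: m_def matrix_vector_mult_scaleR power2_eq_square field_simps)
    then show ?thesis using False by (simp add: field_simps power2_norm_eq_inner)
  qed simp
  define r where "r = A *v x - m *\<^sub>R x"
  define Q where "Q = r \<bullet> (A *v r) - m * (r \<bullet> r)"
  have ur: "u \<bullet> r = 0"
    using symmetric_matrix_inner[OF sym, of u x] Au xx by (simp add: r_def inner_diff_right)
  have Q0: "Q \<ge> 0" using min[OF ur] by (simp add: Q_def)
  have ineq: "0 \<le> 2 * t * (r \<bullet> r) + t\<^sup>2 * Q" for t
  proof -
    have "u \<bullet> (x + t *\<^sub>R r) = 0" using ur xx by (simp add: inner_add_right)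
    from min[OF this]
    have "m * (1 + 2 * t * (x \<bullet> r) + t\<^sup>2 * (r \<bullet> r)) \<le> m + 2 * t * (r \<bullet> (A *v x)) + t\<^sup>2 * (r \<bullet> (A *v r))"
      using xx symmetric_matrix_inner[OF sym, of x r]
      by (simp add: m_def matrix_vector_right_distrib matrix_vector_mult_scaleR inner_add_left
          inner_add_right inner_commute power2_eq_square algebra_simps)
    moreover have "m * (1 + 2 * t * (x \<bullet> r) + t\<^sup>2 * (r \<bullet> r))
        = m + m * (2 * t * (x \<bullet> r)) + t\<^sup>2 * (m * (r \<bullet> r))"
      by (simp add: algebra_simps)
    moreover have "t\<^sup>2 * Q = t\<^sup>2 * (r \<bullet> (A *v r)) - t\<^sup>2 * (m * (r \<bullet> r))"
      by (simp add: Q_def algebra_simps)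
    moreover have rr: "r \<bullet> r = r \<bullet> (A *v x) - m * (x \<bullet> r)"
      by (subst (2) r_def) (simp add: inner_diff_right inner_commute)
    have "2 * t * (r \<bullet> r) = 2 * t * (r \<bullet> (A *v x)) - m * (2 * t * (x \<bullet> r))"
      by (subst rr) (simp add: algebra_simps)
    ultimately show ?thesis by linarith
  qed
  have "r \<bullet> r = 0"
  proof (rule ccontr)
    assume "r \<bullet> r \<noteq> 0"
    define R where "R = r \<bullet> r"
    have R: "R > 0" using \<open>r \<bullet> r \<noteq> 0\<close> by (simp add: R_def)
    \<comment> \<open>A small step against the residual: at \<open>t = - c\<close> the linear term
      outweighs the quadratic one. The summand 1 keeps the denominator positive when
      \<open>Q = 0\<close>.\<close>
    define c where "c = R / (Q + 1)"
    have c: "c > 0" "R = c * (Q + 1)" using R Q0 by (simp_all add: c_def)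
    have "0 \<le> 2 * (- c) * R + (- c)\<^sup>2 * Q" using ineq unfolding R_def .
    also have "\<dots> = c\<^sup>2 * (- 2 - Q)"
      unfolding c(2) by (simp add: power2_eq_square algebra_simps)
    also have "\<dots> < 0" using c(1) Q0 by (intro mult_pos_neg) auto
    finally show False by simp
  qed
  then have "A *v x = m *\<^sub>R x" by (simp add: r_def)
  moreover have "x \<noteq> 0" using xx by auto
  ultimately show ?thesis using that xx min by blast
qed

subsection \<open>The normalized Laplacian of a connected graph\<close>

locale connected_simple_graph =
  fixes E :: "'v::finite set set"
  assumes simple: "simple_graph E" and conn: "connected_graph E" and nonempty: "E \<noteq> {}"
begin

abbreviation "N \<equiv> neighbours E"
abbreviation "deg \<equiv> vertex_degree E"

lemma edge_neq: "{v, w} \<in> E \<Longrightarrow> v \<noteq> w"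
  using simple by (force simp: simple_graph_def)

lemma edge_obtain: obtains a b where "{a, b} \<in> E" "a \<noteq> b"
  using nonempty simple by (metis card_2_iff ex_in_conv simple_graph_def)

lemma neighbours_sym: "w \<in> N v \<longleftrightarrow> v \<in> N w"
  by (simp add: neighbours_def insert_commute)

text \<open>Some edge exists, so there is a second vertex, and the first step of a path to it leads
  to a neighbour.\<close>

lemma neighbours_nonempty: "N v \<noteq> {}"
proof -
  obtain a b where "{a, b} \<in> E" "a \<noteq> b" by (rule edge_obtain)
  then obtain w where "w \<noteq> v" by metis
  have "(v, w) \<in> {(x, y). {x, y} \<in> E}\<^sup>*" using conn by (simp add: connected_graph_def)
  then show ?thesis
    using \<open>w \<noteq> v\<close> by (cases rule: converse_rtranclE) (auto simp: neighbours_def)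
qed

lemma deg_pos: "real (deg v) > 0"
  using neighbours_nonempty[of v] by (simp add: vertex_degree_def card_gt_0_iff)

text \<open>Adjacency is symmetric, so reversing all oriented edges only permutes the
  summands.\<close>

lemma sum_neighbours_swap:
  fixes F :: "'v \<Rightarrow> 'v \<Rightarrow> real"
  shows "(\<Sum>v\<in>UNIV. \<Sum>w\<in>N v. F v w) = (\<Sum>v\<in>UNIV. \<Sum>w\<in>N v. F w v)"
proof -
  have "(\<Sum>v\<in>UNIV. \<Sum>w\<in>N v. F v w) = (\<Sum>v\<in>UNIV. \<Sum>w\<in>UNIV. if w \<in> N v then F v w else 0)"
    by (simp add: sum.If_cases)
  also have "\<dots> = (\<Sum>w\<in>UNIV. \<Sum>v\<in>UNIV. if v \<in> N w then F v w else 0)"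
    by (subst sum.swap) (simp add: neighbours_sym)
  also have "\<dots> = (\<Sum>v\<in>UNIV. \<Sum>w\<in>N v. F w v)"
    by (simp add: sum.If_cases)
  finally show ?thesis .
qed

lemma sum_neighbours_const: "(\<Sum>w\<in>N v. c) = real (deg v) * c"
  by (simp add: vertex_degree_def)

lemma laplacian_sym: "transpose (normalized_laplacian E) = normalized_laplacian E"
  by (simp add: transpose_def normalized_laplacian_def vec_eq_iff insert_commute mult.commute)

lemma laplacian_mult:
  "(normalized_laplacian E *v x) $ v
     = x $ v - (\<Sum>w\<in>N v. x $ w / sqrt (real (deg v) * real (deg w)))"
proof -
  have "(normalized_laplacian E *v x) $ v =
     (\<Sum>w\<in>UNIV. (if w = v then x $ v else 0)
        - (if w \<in> N v then x $ w / sqrt (real (deg v) * real (deg w)) else 0))"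
    unfolding matrix_vector_mult_def normalized_laplacian_def
    using edge_neq[of v v] by (simp, intro sum.cong) (auto simp: neighbours_def)
  then show ?thesis by (simp add: sum_subtractf sum.If_cases)
qed

text \<open>Functions on the vertices, with the inner product weighted by the degree, are embedded
  isometrically by \<open>scaled\<close>; constant functions become the kernel of the Laplacian.\<close>

definition scaled :: "('v \<Rightarrow> real) \<Rightarrow> real^'v" where
  "scaled k = (\<chi> v. sqrt (real (deg v)) * k v)"

lemma scaled_surj: "\<exists>k. x = scaled k"
  using deg_pos less_imp_neq
  by (intro exI[of _ "\<lambda>v. x $ v / sqrt (real (deg v))"]) (fastforce simp: scaled_def vec_eq_iff)

lemma scaled_inner: "scaled j \<bullet> scaled k = (\<Sum>v\<in>UNIV. real (deg v) * j v * k v)"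
  unfolding scaled_def inner_vec_def
proof (simp, intro sum.cong refl)
  fix v
  have "sqrt (real (deg v)) * j v * (sqrt (real (deg v)) * k v)
      = (sqrt (real (deg v)) * sqrt (real (deg v))) * j v * k v"
    by (simp only: mult_ac)
  then show "sqrt (real (deg v)) * j v * (sqrt (real (deg v)) * k v) = real (deg v) * j v * k v"
    by simp
qed

text \<open>In degree-weighted coordinates the normalized Laplacian becomes a sum of differences
  along edges, which visibly annihilates constants.\<close>

lemma laplacian_scaled:
  "(normalized_laplacian E *v scaled k) $ v = (\<Sum>w\<in>N v. k v - k w) / sqrt (real (deg v))"
proof -
  have "sqrt (real (deg v)) \<noteq> 0" for v using deg_pos[of v] by simp
  then have "(normalized_laplacian E *v scaled k) $ v
      = sqrt (real (deg v)) * k v - (\<Sum>w\<in>N v. k w) / sqrt (real (deg v))"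
    by (simp add: laplacian_mult scaled_def real_sqrt_mult sum_divide_distrib)
  also have "\<dots> = (real (deg v) * k v - (\<Sum>w\<in>N v. k w)) / sqrt (real (deg v))"
    using deg_pos[of v] by (simp add: diff_divide_distrib real_div_sqrt flip: times_divide_eq_left)
  finally show ?thesis by (simp only: sum_subtractf sum_neighbours_const)
qed

lemma laplacian_form:
  "scaled k \<bullet> (normalized_laplacian E *v scaled k)
     = (\<Sum>v\<in>UNIV. real (deg v) * (k v)\<^sup>2) - (\<Sum>v\<in>UNIV. \<Sum>w\<in>N v. k v * k w)"
proof -
  have "scaled k $ v * (normalized_laplacian E *v scaled k) $ v = k v * (\<Sum>w\<in>N v. k v - k w)" for v
    using deg_pos[of v] by (simp add: laplacian_scaled) (simp add: scaled_def)
  then have "scaled k \<bullet> (normalized_laplacian E *v scaled k) = (\<Sum>v\<in>UNIV. k v * (\<Sum>w\<in>N v. k v - k w))"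
    by (simp add: inner_vec_def)
  also have "\<dots> = (\<Sum>v\<in>UNIV. real (deg v) * (k v)\<^sup>2 - (\<Sum>w\<in>N v. k v * k w))"
    by (intro sum.cong refl)
      (simp add: sum_subtractf vertex_degree_def sum_distrib_left right_diff_distrib power2_eq_square)
  finally show ?thesis by (simp add: sum_subtractf)
qed

lemma sum_deg_neighbours:
  "(\<Sum>v\<in>UNIV. \<Sum>w\<in>N v. (k v)\<^sup>2) = (\<Sum>v\<in>UNIV. real (deg v) * (k v)\<^sup>2)"
  by (simp only: sum_neighbours_const)

text \<open>The sign \<open>s = - 1\<close> gives twice the Laplacian form, hence its positivity;
  \<open>s = 1\<close> gives the upper bound 2 for its Rayleigh quotient.\<close>

lemma sum_square_neighbours:
  fixes k :: "'v \<Rightarrow> real"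
  assumes "\<bar>s\<bar> = 1"
  shows "(\<Sum>v\<in>UNIV. \<Sum>w\<in>N v. (k v + s * k w)\<^sup>2)
     = 2 * ((\<Sum>v\<in>UNIV. real (deg v) * (k v)\<^sup>2) + s * (\<Sum>v\<in>UNIV. \<Sum>w\<in>N v. k v * k w))"
proof -
  have "s * s = 1" using assms by (metis abs_mult_self_eq mult_1)
  then have "(k v + s * k w)\<^sup>2 = (k v)\<^sup>2 + (k w)\<^sup>2 + 2 * s * (k v * k w)" for v w
    by (simp add: power2_eq_square algebra_simps)
  then have "(\<Sum>v\<in>UNIV. \<Sum>w\<in>N v. (k v + s * k w)\<^sup>2) =
     (\<Sum>v\<in>UNIV. \<Sum>w\<in>N v. (k v)\<^sup>2) + (\<Sum>v\<in>UNIV. \<Sum>w\<in>N v. (k w)\<^sup>2)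
       + 2 * s * (\<Sum>v\<in>UNIV. \<Sum>w\<in>N v. k v * k w)"
    by (simp add: sum.distrib sum_distrib_left)
  then show ?thesis
    using sum_neighbours_swap[of "\<lambda>v w. (k v)\<^sup>2"] sum_deg_neighbours[of k] by simp
qed

section \<open>Positivity on the complement of the constants and the first positive
  eigenvalue\<close>

lemma neighbours_const_imp_const:
  assumes "\<And>v w. w \<in> N v \<Longrightarrow> k v = k w"
  shows "k v = k w"
proof -
  have "(v, w) \<in> {(x, y). {x, y} \<in> E}\<^sup>*" using conn by (simp add: connected_graph_def)
  then show ?thesis
    by (induction rule: rtrancl_induct) (use assms in \<open>auto simp: neighbours_def\<close>)
qed

text \<open>If the sum of squared differences along edges is zero, \<open>k\<close> is constant by
  connectivity, and a constant orthogonal to the constants vanishes.\<close>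

lemma laplacian_form_pos:
  assumes "scaled k \<noteq> 0" "scaled (\<lambda>_. 1) \<bullet> scaled k = 0"
  shows "scaled k \<bullet> (normalized_laplacian E *v scaled k) > 0"
proof (rule ccontr)
  assume "\<not> ?thesis"
  then have "(\<Sum>v\<in>UNIV. \<Sum>w\<in>N v. (k v + (- 1) * k w)\<^sup>2) \<le> 0"
    by (subst sum_square_neighbours) (simp_all add: laplacian_form)
  moreover have "(\<Sum>v\<in>UNIV. \<Sum>w\<in>N v. (k v + (- 1) * k w)\<^sup>2) \<ge> 0"
    by (intro sum_nonneg) simp
  ultimately have 0: "(\<Sum>v\<in>UNIV. \<Sum>w\<in>N v. (k v + (- 1) * k w)\<^sup>2) = 0" by simp
  then have "\<forall>v\<in>UNIV. (\<Sum>w\<in>N v. (k v + (- 1) * k w)\<^sup>2) = 0"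
    by (subst (asm) sum_nonneg_eq_0_iff) (auto intro: sum_nonneg)
  then have "k v = k w" if "w \<in> N v" for v w
    using that by (auto simp: sum_nonneg_eq_0_iff)
  then have const: "k v = k w" for v w by (rule neighbours_const_imp_const)
  obtain a :: 'v where True by simp
  have "k v = k a" for v by (rule const)
  then have "scaled k = k a *\<^sub>R scaled (\<lambda>_. 1)" by (simp add: scaled_def vec_eq_iff)
  then show False using assms by (metis inner_eq_zero_iff inner_scaleR_left mult_eq_0_iff scaleR_eq_0_iff inner_commute)
qed

text \<open>The minimum of the Rayleigh quotient on the complement of the constants is itself a
  positive eigenvalue. It therefore bounds the least one from above, and its variational inequality
  passes to that one.\<close>

lemma first_eigenvalue_Rayleigh:
  defines "l \<equiv> first_positive_eigenvalue (normalized_laplacian E)"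
  shows "eigenvalue (normalized_laplacian E) l" "0 < l" "l \<le> 2"
    "\<And>y. scaled (\<lambda>_. 1) \<bullet> y = 0 \<Longrightarrow> l * (y \<bullet> y) \<le> y \<bullet> (normalized_laplacian E *v y)"
proof -
  let ?L = "normalized_laplacian E"
  obtain a b where ab: "{a, b} \<in> E" "a \<noteq> b" by (rule edge_obtain)
  \<comment> \<open>The reciprocal degrees cancel the weights of the inner product, so that the
    contributions of the two endpoints add up to zero against constants.\<close>
  define z where "z = scaled (\<lambda>v. if v = a then 1 / real (deg a) else if v = b then - 1 / real (deg b) else 0)"
  have "z $ a \<noteq> 0" using deg_pos[of a] by (simp add: z_def scaled_def)
  then have z0: "z \<noteq> 0" by auto
  have "scaled (\<lambda>_. 1) \<bullet> z = (\<Sum>v\<in>UNIV. (if v = a then 1 else 0) - (if v = b then 1 else 0))"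
    unfolding z_def scaled_inner using ab deg_pos by (intro sum.cong) (auto simp: less_imp_neq[symmetric])
  then have zu: "scaled (\<lambda>_. 1) \<bullet> z = 0" by (simp add: sum_subtractf)
  have Lu: "?L *v scaled (\<lambda>_. 1) = 0" by (simp add: vec_eq_iff laplacian_scaled)
  from Rayleigh_minimum_orthogonal[OF laplacian_sym Lu z0 zu]
  obtain m x where x: "x \<noteq> 0" "scaled (\<lambda>_. 1) \<bullet> x = 0" "?L *v x = m *\<^sub>R x"
    and min: "\<And>y. scaled (\<lambda>_. 1) \<bullet> y = 0 \<Longrightarrow> m * (y \<bullet> y) \<le> y \<bullet> (?L *v y)" by metis
  obtain k where k: "x = scaled k" using scaled_surj by metis
  have xx: "x \<bullet> x > 0" using x by simp
  have mx: "x \<bullet> (?L *v x) = m * (x \<bullet> x)" using x by simp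
  have "m * (x \<bullet> x) > 0" using laplacian_form_pos[of k] x mx k by simp
  then have m0: "m > 0" using xx by (simp add: zero_less_mult_iff)
  have "(\<Sum>v\<in>UNIV. \<Sum>w\<in>N v. (k v + 1 * k w)\<^sup>2) \<ge> 0"
    by (intro sum_nonneg) simp
  then have "x \<bullet> (?L *v x) \<le> 2 * (x \<bullet> x)"
    unfolding sum_square_neighbours[of 1, simplified]
    by (subst (asm) sum_square_neighbours) (simp_all add: k laplacian_form scaled_inner power2_eq_square mult.assoc)
  then have m2: "m \<le> 2" using xx mx by simp
  have fin: "finite {l. 0 < l \<and> eigenvalue ?L l}"
    by (rule finite_subset[OF _ finite_eigenvalues_symmetric[OF laplacian_sym]]) auto
  have mem: "m \<in> {l. 0 < l \<and> eigenvalue ?L l}" using m0 x by (auto simp: eigenvalue_def)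
  have lm: "l \<le> m" unfolding l_def first_positive_eigenvalue_def using fin mem by (rule Min_le)
  have "l \<in> {l. 0 < l \<and> eigenvalue ?L l}"
    unfolding l_def first_positive_eigenvalue_def using fin mem by (intro Min_in) auto
  then show "eigenvalue ?L l" "0 < l" by auto
  show "l \<le> 2" using lm m2 by simp
  show "l * (y \<bullet> y) \<le> y \<bullet> (?L *v y)" if "scaled (\<lambda>_. 1) \<bullet> y = 0" for y
    using min[OF that] mult_right_mono[OF lm, of "y \<bullet> y"] by simp
qed

text \<open>Here the Laplacian is \<open>n / (n - 1)\<close> times the identity minus
  \<open>1 / (n - 1)\<close> times the all-ones matrix. Summing the coordinates of the eigenvalue
  equation gives \<open>l * S = 0\<close>; as \<open>l\<close> is positive, \<open>S = 0\<close>,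
  and any nonzero coordinate then yields \<open>l\<close>.\<close>

lemma first_eigenvalue_complete:
  assumes "complete_graph E"
  shows "first_positive_eigenvalue (normalized_laplacian E) = real CARD('v) / (real CARD('v) - 1)"
proof -
  define l where "l = first_positive_eigenvalue (normalized_laplacian E)"
  define n where "n = real CARD('v)"
  have N: "N v = UNIV - {v}" for v
    using assms edge_neq by (auto simp: complete_graph_def neighbours_def)
  have deg: "real (deg v) = n - 1" for v
    by (simp add: vertex_degree_def N card_Diff_singleton n_def of_nat_diff Suc_leI)
  obtain v0 :: 'v where True by simp
  have n1: "n > 1" using deg_pos[of v0] deg[of v0] by simp
  obtain x where x: "x \<noteq> 0" "normalized_laplacian E *v x = l *\<^sub>R x"
    using first_eigenvalue_Rayleigh(1) unfolding l_def eigenvalue_def by blast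
  define S where "S = (\<Sum>v\<in>UNIV. x $ v)"
  have eq: "l * x $ v = n / (n - 1) * x $ v - S / (n - 1)" for v
  proof -
    have "l * x $ v = (normalized_laplacian E *v x) $ v" by (simp add: x)
    also have "\<dots> = x $ v - (\<Sum>w\<in>UNIV - {v}. x $ w) / (n - 1)"
      using n1 by (simp add: laplacian_mult N deg sum_divide_distrib)
    also have "(\<Sum>w\<in>UNIV - {v}. x $ w) = S - x $ v" by (simp add: S_def sum_diff1)
    also have "x $ v - (S - x $ v) / (n - 1) = n / (n - 1) * x $ v - S / (n - 1)"
      using n1 by (simp add: divide_simps) (simp add: algebra_simps)
    finally show ?thesis .
  qed
  have "l * S = (\<Sum>v\<in>UNIV. n / (n - 1) * x $ v - S / (n - 1))"
    unfolding eq[symmetric] by (simp add: S_def sum_distrib_left)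
  also have "\<dots> = n / (n - 1) * S - n * (S / (n - 1))"
    unfolding sum_subtractf S_def sum_distrib_left by (simp add: n_def)
  finally have "S = 0" using first_eigenvalue_Rayleigh(2) by (simp add: l_def)
  moreover obtain v where "x $ v \<noteq> 0" using x by (auto simp: vec_eq_iff)
  ultimately have "(l - n / (n - 1)) * x $ v = 0" "x $ v \<noteq> 0"
    using eq[of v] by (simp_all add: left_diff_distrib)
  then have "l = n / (n - 1)" by simp
  then show ?thesis by (simp add: l_def n_def)
qed

end

subsection \<open>The linear system at the vertices\<close>

lemma quadratic_form_angle_mono:
  fixes a b x y :: real
  assumes "0 < x" "x \<le> y" "y < pi"
  shows "(2 * a * b - (a\<^sup>2 + b\<^sup>2) * cos x) / sin x \<le> (2 * a * b - (a\<^sup>2 + b\<^sup>2) * cos y) / sin y"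
proof -
  \<comment> \<open>In terms of the half angle, both summands are visibly increasing.\<close>
  have half: "(2 * a * b - (a\<^sup>2 + b\<^sup>2) * cos z) / sin z
      = ((a + b)\<^sup>2 * tan (z / 2) - (a - b)\<^sup>2 * inverse (tan (z / 2))) / 2" (is "?l = ?r")
    if z: "0 < z" "z < pi" for z
  proof -
    define s c where "s = sin (z / 2)" and "c = cos (z / 2)"
    have pos: "s > 0" "c > 0"
      using z by (auto simp: s_def c_def intro!: sin_gt_zero cos_gt_zero_pi)
    have one: "s * s + c * c = 1"
      using sin_cos_squared_add[of "z / 2"] by (simp only: s_def c_def power2_eq_square)
    have sin_z: "sin z = 2 * s * c" and "cos z = c * c - s * s"
      using sin_double[of "z / 2"] cos_double[of "z / 2"] by (simp_all add: s_def c_def power2_eq_square)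
    \<comment> \<open>Writing 1 as \<open>s * s + c * c\<close> makes the numerator homogeneous in
      \<open>s\<close> and \<open>c\<close>; it then equals
      \<open>(s * (a + b))\<^sup>2 - (c * (a - b))\<^sup>2\<close>.\<close>
    then have "2 * a * b - (a\<^sup>2 + b\<^sup>2) * cos z
        = 2 * a * b * (s * s + c * c) - (a\<^sup>2 + b\<^sup>2) * (c * c - s * s)"
      by (simp only: one mult_1_right)
    then have "?l = (2 * a * b * (s * s + c * c) - (a\<^sup>2 + b\<^sup>2) * (c * c - s * s)) / (2 * s * c)"
      by (simp only: sin_z)
    also have "\<dots> = ?r"
      using pos unfolding tan_def s_def[symmetric] c_def[symmetric]
      by (simp add: field_simps power2_eq_square)
    finally show ?thesis .
  qed
  have "0 < tan (x / 2)" using assms by (intro tan_gt_zero) auto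
  moreover have "tan (x / 2) \<le> tan (y / 2)" using assms by (intro tan_mono_le) auto
  ultimately show ?thesis
    using assms unfolding half[OF assms(1) order_le_less_trans[OF assms(2,3)]]
      half[OF order_less_le_trans[OF assms(1,2)] assms(3)]
    by (intro divide_right_mono diff_mono mult_left_mono le_imp_inverse_le) auto
qed

context connected_simple_graph
begin

lemma scaled_eq_0_iff: "scaled k = 0 \<longleftrightarrow> k = (\<lambda>_. 0)"
proof -
  have "sqrt (real (deg v)) * k v = 0 \<longleftrightarrow> k v = 0" for v using deg_pos[of v] by simp
  then show ?thesis by (simp only: scaled_def vec_eq_iff fun_eq_iff vec_lambda_beta zero_index)
qed

lemma first_eigenvalue_le_of_vertex_system:
  fixes g :: "'v \<Rightarrow> real" and x :: "'v \<Rightarrow> 'v \<Rightarrow> real"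
  assumes sym: "\<And>v w. x v w = x w v"
    and x: "\<And>v w. w \<in> N v \<Longrightarrow> 0 < x v w \<and> x v w \<le> X" and X: "0 < X" "X < pi"
    and eq: "\<And>v. (\<Sum>w\<in>N v. (g w - g v * cos (x v w)) / sin (x v w)) = 0"
    and g: "g \<noteq> (\<lambda>_. 0)"
  shows "first_positive_eigenvalue (normalized_laplacian E) \<le> 1 - cos X"
proof -
  let ?L = "normalized_laplacian E"
  \<comment> \<open>\<open>T\<close> is the operator of the vertex equations applied to the constant
    function 1.\<close>
  define T where "T v = (\<Sum>w\<in>N v. (1 - cos (x v w)) / sin (x v w))" for v
  have T: "T v > 0" for v
    unfolding T_def
  proof (rule sum_pos)
    fix w assume "w \<in> N v"
    then have "0 < x v w" "x v w < pi" using x[of w v] X by auto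
    then show "0 < (1 - cos (x v w)) / sin (x v w)"
      using cos_monotone_0_pi[of 0 "x v w"] by (simp add: sin_gt_zero)
  qed (auto simp: neighbours_nonempty)
  have sumT: "(\<Sum>v\<in>UNIV. T v) > 0" using T by (intro sum_pos) auto
  \<comment> \<open>The operator is symmetric, so pairing the constant 1 with the kernel vector
    \<open>g\<close> gives zero.\<close>
  have "(\<Sum>v\<in>UNIV. g v * T v)
      = (\<Sum>v\<in>UNIV. \<Sum>w\<in>N v. g v / sin (x v w)) - (\<Sum>v\<in>UNIV. \<Sum>w\<in>N v. g v * cos (x v w) / sin (x v w))"
    by (simp add: T_def sum_distrib_left right_diff_distrib diff_divide_distrib sum_subtractf)
  also have "(\<Sum>v\<in>UNIV. \<Sum>w\<in>N v. g v / sin (x v w)) = (\<Sum>v\<in>UNIV. \<Sum>w\<in>N v. g w / sin (x v w))"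
    by (subst sum_neighbours_swap) (simp add: sym)
  also have "\<dots> - (\<Sum>v\<in>UNIV. \<Sum>w\<in>N v. g v * cos (x v w) / sin (x v w))
      = (\<Sum>v\<in>UNIV. \<Sum>w\<in>N v. (g w - g v * cos (x v w)) / sin (x v w))"
    by (simp add: diff_divide_distrib sum_subtractf)
  finally have gT: "(\<Sum>v\<in>UNIV. g v * T v) = 0" by (simp add: eq)

  define sdeg where "sdeg = (\<Sum>v\<in>UNIV. real (deg v))"
  have sdeg: "sdeg > 0" unfolding sdeg_def using deg_pos by (intro sum_pos) auto
  \<comment> \<open>Shifting \<open>g\<close> by \<open>t\<close> makes it orthogonal to the kernel of the Laplacian.\<close>
  define t where "t = - (\<Sum>v\<in>UNIV. real (deg v) * g v) / sdeg"
  define k where "k v = g v + t" for v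
  have "(\<Sum>v\<in>UNIV. real (deg v) * k v) = (\<Sum>v\<in>UNIV. real (deg v) * g v) + sdeg * t"
    by (simp add: k_def distrib_left sum.distrib sum_distrib_right sdeg_def)
  then have orth: "scaled (\<lambda>_. 1) \<bullet> scaled k = 0"
    using sdeg by (simp add: scaled_inner t_def)
  \<comment> \<open>Otherwise \<open>g\<close> would be the constant \<open>- t\<close>; being
    orthogonal to the positive \<open>T\<close>, it would be zero.\<close>
  have "k \<noteq> (\<lambda>_. 0)"
  proof
    assume "k = (\<lambda>_. 0)"
    then have gt: "g v = - t" for v by (metis k_def add_eq_0_iff2)
    then have "t * (\<Sum>v\<in>UNIV. T v) = 0" using gT by (simp add: sum_negf flip: sum_distrib_left)
    then have "t = 0" using sumT by simp
    then show False using gt g by auto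
  qed
  then have k0: "scaled k \<noteq> 0" by (simp add: scaled_eq_0_iff)

  have k_eq: "(\<Sum>w\<in>N v. (k w - k v * cos (x v w)) / sin (x v w)) = t * T v" for v
  proof -
    have "(\<Sum>w\<in>N v. (k w - k v * cos (x v w)) / sin (x v w))
        = (\<Sum>w\<in>N v. (g w - g v * cos (x v w)) / sin (x v w) + t * ((1 - cos (x v w)) / sin (x v w)))"
      by (intro sum.cong refl) (simp add: k_def algebra_simps flip: add_divide_distrib)
    then show ?thesis by (simp add: sum.distrib eq T_def sum_distrib_left)
  qed
  \<comment> \<open>The value of the form at \<open>k = g + t\<close>: the cross term vanishes by
    \<open>gT\<close>, which leaves \<open>t\<^sup>2\<close> times the positive sum of
    \<open>T\<close>.\<close>
  let ?S = "\<Sum>v\<in>UNIV. \<Sum>w\<in>N v. k v * ((k w - k v * cos (x v w)) / sin (x v w))"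
  have "?S = (\<Sum>v\<in>UNIV. k v * (t * T v))"
    by (simp only: k_eq[symmetric] sum_distrib_left)
  also have "\<dots> = t * (\<Sum>v\<in>UNIV. g v * T v) + t\<^sup>2 * (\<Sum>v\<in>UNIV. T v)"
    by (simp add: k_def sum_distrib_left sum.distrib power2_eq_square algebra_simps)
  finally have S0: "?S \<ge> 0" using gT sumT by simp
  \<comment> \<open>Adding the sum over the reversed edges makes each summand symmetric in its two
    endpoints, as monotonicity in the angle requires.\<close>
  have "2 * ?S = ?S + (\<Sum>v\<in>UNIV. \<Sum>w\<in>N v. k w * ((k v - k w * cos (x v w)) / sin (x v w)))"
    using sum_neighbours_swap[of "\<lambda>v w. k v * ((k w - k v * cos (x v w)) / sin (x v w))"]
    by (simp add: sym[of _ v for v])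
  also have "\<dots> = (\<Sum>v\<in>UNIV. \<Sum>w\<in>N v. (2 * k v * k w - ((k v)\<^sup>2 + (k w)\<^sup>2) * cos (x v w)) / sin (x v w))"
    unfolding sum.distrib[symmetric]
    by (intro sum.cong refl) (simp add: power2_eq_square algebra_simps flip: add_divide_distrib)
  also have "\<dots> \<le> (\<Sum>v\<in>UNIV. \<Sum>w\<in>N v. (2 * k v * k w - ((k v)\<^sup>2 + (k w)\<^sup>2) * cos X) / sin X)"
    using x X by (intro sum_mono quadratic_form_angle_mono) auto
  also have "\<dots> = (2 * (\<Sum>v\<in>UNIV. \<Sum>w\<in>N v. k v * k w)
      - ((\<Sum>v\<in>UNIV. \<Sum>w\<in>N v. (k v)\<^sup>2) + (\<Sum>v\<in>UNIV. \<Sum>w\<in>N v. (k w)\<^sup>2)) * cos X) / sin X"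
    by (simp add: sum_subtractf sum_distrib_left sum_distrib_right sum_divide_distrib sum.distrib
        diff_divide_distrib add_divide_distrib algebra_simps)
  also have "(\<Sum>v\<in>UNIV. \<Sum>w\<in>N v. (k w)\<^sup>2) = (\<Sum>v\<in>UNIV. \<Sum>w\<in>N v. (k v)\<^sup>2)"
    by (rule sum_neighbours_swap)
  finally have "0 \<le> (2 * (\<Sum>v\<in>UNIV. \<Sum>w\<in>N v. k v * k w)
      - 2 * (\<Sum>v\<in>UNIV. real (deg v) * (k v)\<^sup>2) * cos X) / sin X"
    using S0 sum_deg_neighbours[of k] by simp
  moreover have "sin X > 0" using X by (rule sin_gt_zero)
  ultimately have "(\<Sum>v\<in>UNIV. real (deg v) * (k v)\<^sup>2) * cos X \<le> (\<Sum>v\<in>UNIV. \<Sum>w\<in>N v. k v * k w)"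
    by (simp add: zero_le_divide_iff)
  then have "scaled k \<bullet> (?L *v scaled k) \<le> (1 - cos X) * (scaled k \<bullet> scaled k)"
    unfolding laplacian_form by (simp add: scaled_inner power2_eq_square algebra_simps)
  with first_eigenvalue_Rayleigh(4)[OF orth]
  have "first_positive_eigenvalue ?L * (scaled k \<bullet> scaled k) \<le> (1 - cos X) * (scaled k \<bullet> scaled k)"
    by (rule order_trans)
  then show ?thesis using k0 by simp
qed

end

subsection \<open>Homogeneous harmonic functions on a sector\<close>

text \<open>The points of the upper half plane with argument below \<theta> form an open subset of
  the sector, since \<open>Arg\<close> is continuous there.\<close>

lemma polar_in_interior_sector:
  assumes "0 < \<phi>" "\<phi> < \<theta>" "\<theta> < pi" "r > 0"
  shows "rcis r \<phi> \<in> interior (sector \<theta>)"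
proof (rule interiorI)
  let ?U = "{z. Im z > 0} \<inter> Arg -` {..<\<theta>}"
  have "continuous_on {z. Im z > 0} Arg"
    by (intro continuous_at_imp_continuous_on ballI continuous_at_Arg) (auto simp: complex_nonpos_Reals_iff)
  then show "open ?U"
    by (rule continuous_open_preimage) (auto simp: open_halfspace_Im_gt)
  have "sin \<phi> > 0" using assms by (intro sin_gt_zero) auto
  moreover have "Arg (rcis r \<phi>) = \<phi>" using assms by (intro Arg_unique') (auto)
  ultimately show "rcis r \<phi> \<in> ?U" using assms by simp
  show "?U \<subseteq> sector \<theta>"
  proof
    fix z assume "z \<in> ?U"
    then have "0 \<le> Arg z" "Arg z \<le> \<theta>" using Arg_lt_pi[of z] by auto
    then show "z \<in> sector \<theta>"
      unfolding sector_def using rcis_cmod_Arg[of z] by (metis (mono_tags, lifting) mem_Collect_eq norm_ge_zero)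
  qed
qed

text \<open>Rotating the vector with entries \<open>h x\<close> and \<open>h' x / \<alpha>\<close>
  by the angle \<open>\<alpha> * x\<close> gives two constants of the motion, \<open>A\<close> and
  \<open>B\<close>; rotating back recovers \<open>h\<close>.\<close>

lemma harmonic_oscillator_solution:
  fixes h h' :: "real \<Rightarrow> real"
  assumes "\<alpha> \<noteq> 0"
    and h: "\<And>x. x \<in> {a<..<b} \<Longrightarrow> (h has_real_derivative h' x) (at x)"
    and h': "\<And>x. x \<in> {a<..<b} \<Longrightarrow> (h' has_real_derivative - \<alpha>\<^sup>2 * h x) (at x)"
  shows "\<exists>A B. \<forall>x\<in>{a<..<b}. h x = A * cos (\<alpha> * x) + B * sin (\<alpha> * x)"
proof -
  let ?A = "\<lambda>x. h x * cos (\<alpha> * x) - h' x / \<alpha> * sin (\<alpha> * x)"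
  let ?B = "\<lambda>x. h x * sin (\<alpha> * x) + h' x / \<alpha> * cos (\<alpha> * x)"
  have dA: "(?A has_real_derivative 0) (at x within {a<..<b})" if "x \<in> {a<..<b}" for x
    using assms(1)
    by (auto intro!: derivative_eq_intros DERIV_subset[OF h[OF that]] DERIV_subset[OF h'[OF that]]
        simp: power2_eq_square field_simps)
  have dB: "(?B has_real_derivative 0) (at x within {a<..<b})" if "x \<in> {a<..<b}" for x
    using assms(1)
    by (auto intro!: derivative_eq_intros DERIV_subset[OF h[OF that]] DERIV_subset[OF h'[OF that]]
        simp: power2_eq_square field_simps)
  have "\<exists>A. \<forall>x\<in>{a<..<b}. ?A x = A"
    using has_field_derivative_zero_constant[of "{a<..<b}" ?A] dA by blast
  moreover have "\<exists>B. \<forall>x\<in>{a<..<b}. ?B x = B"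
    using has_field_derivative_zero_constant[of "{a<..<b}" ?B] dB by blast
  ultimately obtain A B where A: "\<And>x. x \<in> {a<..<b} \<Longrightarrow> ?A x = A"
    and B: "\<And>x. x \<in> {a<..<b} \<Longrightarrow> ?B x = B" by auto
  have key: "h x = ?A x * cos (\<alpha> * x) + ?B x * sin (\<alpha> * x)" for x
  proof -
    have "?A x * cos (\<alpha> * x) + ?B x * sin (\<alpha> * x)
        = h x * (sin (\<alpha> * x) * sin (\<alpha> * x) + cos (\<alpha> * x) * cos (\<alpha> * x))"
      using assms(1) by (simp add: algebra_simps del: sin_cos_squared_add3)
    also have "sin (\<alpha> * x) * sin (\<alpha> * x) + cos (\<alpha> * x) * cos (\<alpha> * x) = 1"
      by (metis power2_eq_square sin_cos_squared_add)
    finally show ?thesis by (simp only: mult_1_right)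
  qed
  have "h x = A * cos (\<alpha> * x) + B * sin (\<alpha> * x)" if "x \<in> {a<..<b}" for x
    unfolding A[OF that, symmetric] B[OF that, symmetric] by (rule key)
  then show ?thesis by blast
qed

lemma has_derivative_radial:
  fixes F :: "complex \<Rightarrow> real"
  assumes "(F has_derivative (\<lambda>h. Fx * Re h + Fy * Im h)) (at (rcis r \<phi>))"
  shows "((\<lambda>r. F (rcis r \<phi>)) has_real_derivative Fx * cos \<phi> + Fy * sin \<phi>) (at r)"
proof -
  have "((\<lambda>r. rcis r \<phi>) has_derivative (\<lambda>t. of_real t * cis \<phi>)) (at r)"
    unfolding rcis_def by (intro has_derivative_mult_left has_derivative_of_real has_derivative_ident)
  from has_derivative_compose[OF this assms]
  show ?thesis unfolding has_field_derivative_def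
    by (rule has_derivative_eq_rhs) (auto simp: fun_eq_iff algebra_simps)
qed

lemma has_derivative_angular:
  fixes F :: "complex \<Rightarrow> real"
  assumes "(F has_derivative (\<lambda>h. Fx * Re h + Fy * Im h)) (at (cis \<phi>))"
  shows "((\<lambda>\<phi>. F (cis \<phi>)) has_real_derivative - Fx * sin \<phi> + Fy * cos \<phi>) (at \<phi>)"
proof -
  have "(cis has_derivative (\<lambda>t. t *\<^sub>R (\<i> * cis \<phi>))) (at \<phi>)"
    using has_derivative_cis[OF has_derivative_ident] .
  from has_derivative_compose[OF this assms]
  show ?thesis unfolding has_field_derivative_def
    by (rule has_derivative_eq_rhs) (auto simp: fun_eq_iff algebra_simps)
qed

text \<open>On the unit circle the polar form of the Laplace equation expresses the second angular
  derivative through the first two radial ones. Homogeneity makes these \<open>\<alpha> * h\<close>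
  and \<open>\<alpha> * (\<alpha> - 1) * h\<close>, so \<open>h\<close> solves the oscillator
  equation with frequency \<alpha>. Continuity extends the solution to the boundary rays.\<close>

lemma homogeneous_harmonic_sector:
  fixes h :: "real \<Rightarrow> real"
  assumes harm: "harmonic_on (interior (sector \<theta>)) u"
    and u: "\<And>r \<phi>. r > 0 \<Longrightarrow> \<phi> \<in> {0<..<\<theta>} \<Longrightarrow> u (rcis r \<phi>) = h \<phi> * r powr \<alpha>"
    and \<theta>: "0 < \<theta>" "\<theta> < pi" and "\<alpha> > 0" and cont: "continuous_on {0..\<theta>} h"
  shows "\<exists>A B. \<forall>x\<in>{0..\<theta>}. h x = A * cos (\<alpha> * x) + B * sin (\<alpha> * x)"
proof -
  obtain ux uy uxx uxy uyx uyy where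
    *: "\<forall>z\<in>interior (sector \<theta>).
           (u has_derivative (\<lambda>h. ux z * Re h + uy z * Im h)) (at z)
         \<and> (ux has_derivative (\<lambda>h. uxx z * Re h + uxy z * Im h)) (at z)
         \<and> (uy has_derivative (\<lambda>h. uyx z * Re h + uyy z * Im h)) (at z)
         \<and> uxx z + uyy z = 0"
    using harm unfolding harmonic_on_def by (elim conjE exE) (rule that)
  have D: "(u has_derivative (\<lambda>h. ux z * Re h + uy z * Im h)) (at z)"
      "(ux has_derivative (\<lambda>h. uxx z * Re h + uxy z * Im h)) (at z)"
      "(uy has_derivative (\<lambda>h. uyx z * Re h + uyy z * Im h)) (at z)"
    and lap: "uxx z + uyy z = 0" if "z \<in> interior (sector \<theta>)" for z
    using *[rule_format, OF that] by blast+
  have int: "rcis r \<phi> \<in> interior (sector \<theta>)" if "r > 0" "\<phi> \<in> {0<..<\<theta>}" for r \<phi>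
    using that \<theta> by (intro polar_in_interior_sector) auto
  define h1 where "h1 \<phi> = - ux (cis \<phi>) * sin \<phi> + uy (cis \<phi>) * cos \<phi>" for \<phi>
  have der1: "(h has_real_derivative h1 \<phi>) (at \<phi>)" if "\<phi> \<in> {0<..<\<theta>}" for \<phi>
  proof -
    have "cis \<phi> \<in> interior (sector \<theta>)" using int[of 1 \<phi>] that by (simp add: rcis_def)
    from has_derivative_angular[OF D(1)[OF this]]
    have "((\<lambda>\<phi>. u (cis \<phi>)) has_real_derivative h1 \<phi>) (at \<phi>)"
      unfolding h1_def .
    then show ?thesis
      by (rule has_field_derivative_transform_within_open[of _ _ _ "{0<..<\<theta>}"]) (use that u[of 1] in \<open>auto simp: rcis_def\<close>)
  qed
  have der2: "(h1 has_real_derivative - \<alpha>\<^sup>2 * h \<phi>) (at \<phi>)" if \<phi>: "\<phi> \<in> {0<..<\<theta>}" for \<phi>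
  proof -
    let ?z = "cis \<phi>" and ?s = "sin \<phi>" and ?c = "cos \<phi>"
    have z: "?z \<in> interior (sector \<theta>)" using int[of 1 \<phi>] \<phi> by (simp add: rcis_def)
    \<comment> \<open>Both expressions for the radial derivative agree for every positive radius, so
      the identity can be differentiated once more at radius 1.\<close>
    have r1: "ux (rcis r \<phi>) * ?c + uy (rcis r \<phi>) * ?s = h \<phi> * (\<alpha> * r powr (\<alpha> - 1))" if "r > 0" for r
    proof -
      have "((\<lambda>r. u (rcis r \<phi>)) has_real_derivative ux (rcis r \<phi>) * ?c + uy (rcis r \<phi>) * ?s) (at r)"
        using has_derivative_radial[OF D(1)[OF int[OF that \<phi>]]] .
      moreover have "((\<lambda>r. h \<phi> * r powr \<alpha>) has_real_derivative h \<phi> * (\<alpha> * r powr (\<alpha> - 1))) (at r)"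
        using that by (auto intro!: derivative_eq_intros has_real_derivative_powr)
      then have "((\<lambda>r. u (rcis r \<phi>)) has_real_derivative h \<phi> * (\<alpha> * r powr (\<alpha> - 1))) (at r)"
        by (rule has_field_derivative_transform_within_open[of _ _ _ "{0<..}"]) (use that u[OF _ \<phi>] in auto)
      ultimately show ?thesis by (rule DERIV_unique)
    qed
    have "((\<lambda>r. ux (rcis r \<phi>) * ?c + uy (rcis r \<phi>) * ?s) has_real_derivative
        (uxx ?z * ?c + uxy ?z * ?s) * ?c + (uyx ?z * ?c + uyy ?z * ?s) * ?s) (at 1)"
      by (intro DERIV_add DERIV_cmult_right has_derivative_radial) (use D(2,3)[OF z] in \<open>simp_all add: rcis_def\<close>)
    moreover have "((\<lambda>r. h \<phi> * (\<alpha> * r powr (\<alpha> - 1))) has_real_derivative h \<phi> * (\<alpha> * (\<alpha> - 1))) (at 1)"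
      by (auto intro!: derivative_eq_intros)
    then have "((\<lambda>r. ux (rcis r \<phi>) * ?c + uy (rcis r \<phi>) * ?s) has_real_derivative h \<phi> * (\<alpha> * (\<alpha> - 1))) (at 1)"
      by (rule has_field_derivative_transform_within_open[of _ _ _ "{0<..}"]) (use r1 in auto)
    ultimately have r2: "(uxx ?z * ?c + uxy ?z * ?s) * ?c + (uyx ?z * ?c + uyy ?z * ?s) * ?s = h \<phi> * (\<alpha> * (\<alpha> - 1))"
      by (rule DERIV_unique)
    have r1': "ux ?z * ?c + uy ?z * ?s = \<alpha> * h \<phi>" using r1[of 1] by (simp add: rcis_def)
    have "(h1 has_real_derivative
        - ((- uxx ?z * ?s + uxy ?z * ?c) * ?s + ux ?z * ?c)
        + ((- uyx ?z * ?s + uyy ?z * ?c) * ?c - uy ?z * ?s)) (at \<phi>)"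
      unfolding h1_def
      using DERIV_add[OF DERIV_minus[OF DERIV_mult[OF has_derivative_angular[OF D(2)[OF z]] DERIV_sin]]
          DERIV_mult[OF has_derivative_angular[OF D(3)[OF z]] DERIV_cos]]
      by (simp add: algebra_simps)
    moreover have "- ((- uxx ?z * ?s + uxy ?z * ?c) * ?s + ux ?z * ?c)
        + ((- uyx ?z * ?s + uyy ?z * ?c) * ?c - uy ?z * ?s) = - \<alpha>\<^sup>2 * h \<phi>"
    proof -
      \<comment> \<open>The polar Laplacian at radius 1: the second angular derivative is the
        Laplacian minus the first and second radial derivatives.\<close>
      have "- ((- a * s + b * c) * s + p * c) + ((- d * s + e * c) * c - q * s)
          = (a + e) * (s * s + c * c) - (p * c + q * s) - ((a * c + b * s) * c + (d * c + e * s) * s)"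
        for a b d e p q s c :: real
        by (simp add: algebra_simps)
      then have "- ((- uxx ?z * ?s + uxy ?z * ?c) * ?s + ux ?z * ?c)
          + ((- uyx ?z * ?s + uyy ?z * ?c) * ?c - uy ?z * ?s)
        = (uxx ?z + uyy ?z) * (?s * ?s + ?c * ?c) - (ux ?z * ?c + uy ?z * ?s)
          - ((uxx ?z * ?c + uxy ?z * ?s) * ?c + (uyx ?z * ?c + uyy ?z * ?s) * ?s)"
        by this
      also have "\<dots> = - \<alpha>\<^sup>2 * h \<phi>"
        unfolding lap[OF z] r1' r2 by (simp add: power2_eq_square algebra_simps)
      finally show ?thesis .
    qed
    ultimately show ?thesis by simp
  qed
  obtain A B where AB: "\<forall>x\<in>{0<..<\<theta>}. h x = A * cos (\<alpha> * x) + B * sin (\<alpha> * x)"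
    using harmonic_oscillator_solution[OF less_imp_neq[OF \<open>\<alpha> > 0\<close>, symmetric] der1 der2] by blast
  let ?d = "\<lambda>x. h x - (A * cos (\<alpha> * x) + B * sin (\<alpha> * x))"
  have cl: "closure {0<..<\<theta>} = {0..\<theta>}" using \<theta> by simp
  have "continuous_on (closure {0<..<\<theta>}) ?d"
    unfolding cl by (intro continuous_intros cont)
  moreover have "?d x = 0" if "x \<in> {0<..<\<theta>}" for x using bspec[OF AB that] by simp
  ultimately have "?d x = 0" if "x \<in> {0..\<theta>}" for x
    using continuous_constant_on_closure[of "{0<..<\<theta>}" ?d 0 x] that unfolding cl by blast
  then show ?thesis by (intro exI[of _ A] exI[of _ B]) simp
qed

section \<open>The restriction of the function on the cone to a single face\<close>

lemma edge_point_ends [simp]: "edge_point v w 0 = axis v 1" "edge_point v w 1 = axis w 1"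
  by (simp_all add: edge_point_def)

lemma vertex_in_realization [simp]: "axis v 1 \<in> realization E"
  by (simp add: realization_def)

lemma edge_point_in_realization:
  "{v, w} \<in> E \<Longrightarrow> 0 \<le> s \<Longrightarrow> s \<le> 1 \<Longrightarrow> edge_point v w s \<in> realization E"
  unfolding realization_def by blast

text \<open>The sector result applies in coordinates adapted to \<open>v\<close>; evaluation at
  angle 0 identifies the cosine coefficient and leaves the sine coefficient free.\<close>

lemma edge_profile:
  assumes edge: "{v, w} \<in> E" and \<theta>: "0 < \<theta> {v, w}" "\<theta> {v, w} < pi" and "\<alpha> > 0"
    and cont: "continuous_on (realization E) \<rho>"
    and f: "\<And>x t. x \<in> realization E \<Longrightarrow> t \<ge> 0 \<Longrightarrow> f (cone_point (realization E) x t) = \<rho> x * t powr \<alpha>"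
    and harm: "harmonic_on_faces E \<theta> f"
  shows "\<exists>B. \<forall>\<phi>\<in>{0..\<theta> {v, w}}.
    \<rho> (edge_point v w (\<phi> / \<theta> {v, w})) = \<rho> (axis v 1) * cos (\<alpha> * \<phi>) + B * sin (\<alpha> * \<phi>)"
proof -
  let ?h = "\<lambda>\<phi>. \<rho> (edge_point v w (\<phi> / \<theta> {v, w}))"
  have real: "edge_point v w (\<phi> / \<theta> {v, w}) \<in> realization E" if "\<phi> \<in> {0..\<theta> {v, w}}" for \<phi>
    using that edge \<theta> by (intro edge_point_in_realization) auto
  have "continuous_on {0..\<theta> {v, w}} (\<lambda>\<phi>. edge_point v w (\<phi> / \<theta> {v, w}))"
    using \<theta> unfolding edge_point_def by (intro continuous_intros) auto
  then have h: "continuous_on {0..\<theta> {v, w}} ?h"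
    by (rule continuous_on_compose2[OF cont]) (use real in auto)
  have u: "face_fun E \<theta> f v w (cmod (rcis r \<phi>)) (Arg (rcis r \<phi>)) = ?h \<phi> * r powr \<alpha>"
    if "r > 0" "\<phi> \<in> {0<..<\<theta> {v, w}}" for r \<phi>
  proof -
    have "Arg (rcis r \<phi>) = \<phi>" using that \<theta> by (intro Arg_unique') auto
    then show ?thesis using that by (simp add: face_fun_def f real)
  qed
  have harm': "harmonic_on (interior (sector (\<theta> {v, w}))) (\<lambda>z. face_fun E \<theta> f v w (cmod z) (Arg z))"
    using harm edge by (simp add: harmonic_on_faces_def)
  obtain A B where AB: "\<forall>\<phi>\<in>{0..\<theta> {v, w}}. ?h \<phi> = A * cos (\<alpha> * \<phi>) + B * sin (\<alpha> * \<phi>)"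
    using homogeneous_harmonic_sector[OF harm' u \<theta> \<open>\<alpha> > 0\<close> h] by blast
  moreover have "A = \<rho> (axis v 1)" using bspec[OF AB, of 0] \<theta> by simp
  ultimately show ?thesis by blast
qed

subsection \<open>The lower bounds for the degree\<close>

text \<open>With \<open>q = n / (n - 1)\<close> the half-angle formula gives
  \<open>(1 - q\<^sup>2) / (1 + q\<^sup>2)\<close> as the cosine of the left side. That this is at
  least \<open>1 - q\<close> amounts to
  \<open>(2 * n - 1) * (n - 1) \<le> (n - 1)\<^sup>2 + n\<^sup>2\<close>, that is, to
  \<open>n\<close> being nonnegative.\<close>

lemma two_arctan_le_arccos:
  fixes n :: real
  assumes "n \<ge> 2"
  shows "2 * arctan (n / (n - 1)) \<le> arccos (1 - n / (n - 1))"
proof -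
  define q where "q = n / (n - 1)"
  have q: "q \<ge> 0" using assms by (simp add: q_def)
  have n1: "(n - 1) * (n - 1) > 0" "(n - 1)\<^sup>2 + n\<^sup>2 > 0" using assms by (auto intro: add_pos_nonneg)
  have "1 - q = - 1 / (n - 1)" using assms by (simp add: q_def field_simps)
  also have "\<dots> \<le> ((n - 1)\<^sup>2 - n\<^sup>2) / ((n - 1)\<^sup>2 + n\<^sup>2)"
    using assms n1 by (simp add: pos_le_divide_eq divide_simps) (simp add: power2_eq_square algebra_simps)
  also have "\<dots> = (1 - q\<^sup>2) / (1 + q\<^sup>2)"
  proof -
    have "(n - 1)\<^sup>2 - n\<^sup>2 = (n - 1)\<^sup>2 * (1 - q\<^sup>2)" "(n - 1)\<^sup>2 + n\<^sup>2 = (n - 1)\<^sup>2 * (1 + q\<^sup>2)"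
      using assms by (simp_all add: q_def power_divide right_diff_distrib distrib_left)
    then show ?thesis using assms by simp
  qed
  also have "\<dots> = cos (2 * arctan q)"
    by (subst cos_tan_half) (simp_all add: tan_arctan)
  finally have "arccos (cos (2 * arctan q)) \<le> arccos (1 - q)"
    using assms by (intro arccos_le_arccos) (auto simp: q_def field_simps)
  moreover have "arccos (cos (2 * arctan q)) = 2 * arctan q"
    using q arctan_ubound[of q] by (intro arccos_cos) auto
  ultimately show ?thesis by (simp add: q_def)
qed

text \<open>The derivatives in the balancing condition are one-sided; on a nondegenerate interval
  the filter at the left end is the nontrivial \<open>at_right\<close>, so limits are
  unique.\<close>

lemma has_real_derivative_unique_at_left_end:
  fixes F :: "real \<Rightarrow> real"
  assumes "(F has_real_derivative D) (at a within {a..b})" "(F has_real_derivative D') (at a within {a..b})" "a < b"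
  shows "D = D'"
  using assms unfolding has_field_derivative_iff at_within_Icc_at_right[OF assms(3)]
  by (intro tendsto_unique[OF trivial_limit_at_right_real])

theorem theorem3p3:
  fixes E :: "'v::finite set set"
    and \<theta> :: "'v set \<Rightarrow> real"
    and f :: "((real^'v) \<times> real) set \<Rightarrow> real"
    and \<alpha> :: real
  assumes "simple_graph E" and "connected_graph E" and "E \<noteq> {}"
    and "\<And>e. e \<in> E \<Longrightarrow> 0 < \<theta> e \<and> \<theta> e < pi"
    and "\<alpha> > 0"
    and "homogeneous E \<alpha> f"
    and "harmonic_on_faces E \<theta> f"
    and "balanced E \<theta> f"
    and "\<exists>p\<in>cone_space (realization E). f p \<noteq> 0"
  shows "(\<not> complete_graph E \<longrightarrow>
            \<alpha> \<ge> 1 / Max (\<theta> ` E) *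
                 arccos (1 - first_positive_eigenvalue (normalized_laplacian E)))
       \<and> (complete_graph E \<longrightarrow>
            \<alpha> \<ge> 2 / Max (\<theta> ` E) * arctan (real CARD('v) / (real CARD('v) - 1)))"
proof -
  interpret connected_simple_graph E by unfold_locales fact+
  define l where "l = first_positive_eigenvalue (normalized_laplacian E)"
  define M where "M = Max (\<theta> ` E)"
  have M: "\<theta> e \<le> M" if "e \<in> E" for e using that by (simp add: M_def)
  obtain e where "e \<in> E" using assms(3) by blast
  then have M0: "M > 0" using assms(4)[of e] M[of e] by simp
  have l: "0 < l" "l \<le> 2" using first_eigenvalue_Rayleigh by (simp_all add: l_def)
  have main: "arccos (1 - l) \<le> \<alpha> * M"
  \<comment> \<open>From \<pi> on the claim is trivial, as \<open>arccos\<close> takes no larger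
    values; below \<pi> all sines of edge angles are positive.\<close>
  proof (cases "\<alpha> * M < pi")
    case False
    then show ?thesis using l arccos_ubound[of "1 - l"] by linarith
  next
    case X: True
    obtain \<rho> where cont: "continuous_on (realization E) \<rho>"
      and hom: "\<forall>x\<in>realization E. \<forall>t\<ge>0. f (cone_point (realization E) x t) = \<rho> x * t powr \<alpha>"
      using assms(6) unfolding homogeneous_def by (elim exE conjE) (rule that)
    have f: "f (cone_point (realization E) x t) = \<rho> x * t powr \<alpha>" if "x \<in> realization E" "t \<ge> 0" for x t
      using hom that by blast
    define g where "g v = \<rho> (axis v 1)" for v
    define x where "x v w = \<alpha> * \<theta> {v, w}" for v w
    have x: "0 < x v w \<and> x v w \<le> \<alpha> * M" if "{v, w} \<in> E" for v w
      using assms(4)[OF that] M[OF that] assms(5) by (simp add: x_def)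
    have sin_x: "sin (x v w) > 0" if "{v, w} \<in> E" for v w
      using x[OF that] X by (intro sin_gt_zero) auto
    \<comment> \<open>The sine coefficient forced by the value at the far vertex
      \<open>w\<close>.\<close>
    define B where "B v w = (g w - g v * cos (x v w)) / sin (x v w)" for v w
    have B: "\<rho> (edge_point v w (\<phi> / \<theta> {v, w})) = g v * cos (\<alpha> * \<phi>) + B v w * sin (\<alpha> * \<phi>)"
      if edge: "{v, w} \<in> E" and \<phi>: "\<phi> \<in> {0..\<theta> {v, w}}" for v w \<phi>
    proof -
      note ang = assms(4)[OF edge]
      obtain b where b: "\<forall>\<phi>\<in>{0..\<theta> {v, w}}.
          \<rho> (edge_point v w (\<phi> / \<theta> {v, w})) = g v * cos (\<alpha> * \<phi>) + b * sin (\<alpha> * \<phi>)"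
        using edge_profile[OF edge conjunct1[OF ang] conjunct2[OF ang] assms(5) cont f assms(7)]
        unfolding g_def by blast
      have "g w = g v * cos (x v w) + b * sin (x v w)"
        using bspec[OF b, of "\<theta> {v, w}"] ang by (simp add: g_def x_def)
      then have "b = B v w" using sin_x[OF edge] by (simp add: B_def)
      then show ?thesis using b \<phi> by blast
    qed
    \<comment> \<open>The balancing condition is read at radius 1, where the radial factor is 1 and
      the angular derivative at \<open>v\<close> is \<alpha> times the sine coefficient.\<close>
    have vertex_eq: "(\<Sum>w\<in>N v. (g w - g v * cos (x v w)) / sin (x v w)) = 0" for v
    proof -
      obtain D where D: "\<forall>w\<in>N v.
           ((\<lambda>\<phi>. face_fun E \<theta> f v w 1 \<phi>) has_real_derivative D w) (at 0 within {0..\<theta> {v, w}})"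
        and sum_D: "(\<Sum>w\<in>N v. D w) = 0"
        using assms(8)[unfolded balanced_def, THEN spec, of v, rule_format, OF zero_less_one]
        by (elim exE conjE) (rule that)
      have "D w = \<alpha> * B v w" if w: "w \<in> N v" for w
      proof -
        have edge: "{v, w} \<in> E" using w by (simp add: neighbours_def)
        have der: "((\<lambda>\<phi>. g v * cos (\<alpha> * \<phi>) + B v w * sin (\<alpha> * \<phi>)) has_real_derivative \<alpha> * B v w)
            (at 0 within {0..\<theta> {v, w}})"
          by (auto intro!: derivative_eq_intros)
        have eqf: "g v * cos (\<alpha> * \<phi>) + B v w * sin (\<alpha> * \<phi>) = face_fun E \<theta> f v w 1 \<phi>"
          if "\<phi> \<in> {0..\<theta> {v, w}}" for \<phi>
        proof -
          have "edge_point v w (\<phi> / \<theta> {v, w}) \<in> realization E"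
            using edge that assms(4)[OF edge] by (intro edge_point_in_realization) auto
          then show ?thesis using B[OF edge that] by (simp add: face_fun_def f)
        qed
        have "((\<lambda>\<phi>. face_fun E \<theta> f v w 1 \<phi>) has_real_derivative \<alpha> * B v w)
            (at 0 within {0..\<theta> {v, w}})"
          by (rule has_field_derivative_transform_within[OF der zero_less_one _ eqf])
            (use assms(4)[OF edge] in auto)
        then show ?thesis
          using has_real_derivative_unique_at_left_end[OF bspec[OF D w]] assms(4)[OF edge] by simp
      qed
      then have "(\<Sum>w\<in>N v. \<alpha> * B v w) = 0" using sum_D by simp
      then have "(\<Sum>w\<in>N v. B v w) = 0" using assms(5) by (simp flip: sum_distrib_left)
      then show ?thesis by (simp add: B_def)
    qed
    \<comment> \<open>Vertex values determine both coefficients on each edge, so if all were zero,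
      \<open>f\<close> would vanish on the whole cone.\<close>
    have g0: "g \<noteq> (\<lambda>_. 0)"
    proof
      assume gz: "g = (\<lambda>_. 0)"
      have "\<rho> p = 0" if real: "p \<in> realization E" for p
      proof -
        consider (vertex) v where "p = axis v 1"
          | (edge) v w s where "p = edge_point v w s" "{v, w} \<in> E" "0 \<le> s" "s \<le> 1"
          using real unfolding realization_def by (elim UnE rangeE CollectE exE conjE) simp_all
        then show ?thesis
        proof cases
          case vertex
          then show ?thesis using fun_cong[OF gz] by (simp add: g_def)
        next
          case (edge v w s)
          then have "B v w = 0" using gz by (simp add: B_def)
          then show ?thesis
            using B[of v w "s * \<theta> {v, w}"] edge gz assms(4)[of "{v, w}"] by (simp add: mult_le_cancel_right1)
        qed
      qed
      moreover from assms(9) obtain q where "q \<in> cone_space (realization E)" "f q \<noteq> 0" ..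
      then obtain p t where "p \<in> realization E" "t \<ge> 0" "f (cone_point (realization E) p t) \<noteq> 0"
        unfolding cone_space_def cone_point_def by (elim quotientE) auto
      ultimately show False using f by simp
    qed
    have "l \<le> 1 - cos (\<alpha> * M)"
      unfolding l_def
    proof (rule first_eigenvalue_le_of_vertex_system[OF _ _ _ X vertex_eq g0])
      show "x v w = x w v" for v w by (simp add: x_def insert_commute)
      show "0 < x v w \<and> x v w \<le> \<alpha> * M" if "w \<in> N v" for v w
        using that by (intro x) (simp add: neighbours_def)
      show "0 < \<alpha> * M" using M0 assms(5) by simp
    qed
    then have "arccos (1 - l) \<le> arccos (cos (\<alpha> * M))"
      using l by (intro arccos_le_arccos) auto
    also have "\<dots> = \<alpha> * M" using X M0 assms(5) by (intro arccos_cos) auto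
    finally show ?thesis .
  qed
  have "2 * arctan (real CARD('v) / (real CARD('v) - 1)) \<le> \<alpha> * M" if "complete_graph E"
  proof -
    obtain a b :: 'v where "a \<noteq> b" by (rule edge_obtain)
    then have "card {a, b} \<le> CARD('v)" by (intro card_mono) auto
    then have "real CARD('v) \<ge> 2" using \<open>a \<noteq> b\<close> by simp
    from two_arctan_le_arccos[OF this] show ?thesis
      using main first_eigenvalue_complete[OF that] by (simp add: l_def)
  qed
  moreover have "c \<le> \<alpha> * M \<Longrightarrow> c / M \<le> \<alpha>" for c using M0 by (simp add: pos_divide_le_eq)
  ultimately show ?thesis
    using main unfolding l_def M_def by simp
qed

end
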